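(* Let $\beta$ be any real number such that $1<\beta<2$. For $n\in\mathbb{Z}^+$ put $$f(n)=\left(\frac{n-\lfloor\sqrt{n}\rfloor^2-\lfloor\sqrt{n}\rfloor-\beta}{|n-\lfloor\sqrt{n}\rfloor^2-\lfloor\sqrt{n}\rfloor-\beta|}\right)(1-\lfloor\sqrt{n}\rfloor),\qquad g(n)=\left\lfloor 1-\sqrt{n}+\lfloor\sqrt{n}\rfloor\right\rfloor .$$ Then Conjecture C is equivalent to the statement that $$\pi[n+g(n),\,n+f(n)+g(n)]\ge 1\quad\text{for all } n\in\mathbb{Z}^+ .$$
   Context: Conjecture C is the following assertion: for every positive integer $m$, whenever $a_1,a_2,\ldots,a_m$ are $m$ consecutive integers with $m^2<a_1<a_2<\cdots<a_m<(m+1)^2$, at least one of $a_1,\ldots,a_m$ is a prime number. $\lfloor\cdot\rfloor$ denotes the floor function. $\pi[x,y]$ denotes the number of prime numbers in the interval $[x,y]$. Convention: $[x,y]$ denotes the closed interval with endpoints $x$ and $y$ irrespective of their order, i.e. $\{t\in\mathbb{R}: \min(x,y)\le t\le \max(x,y)\}$ (here $f(n)$ may be negative). *)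

theory Defs
  imports Complex_Main "HOL-Computational_Algebra.Primes"
begin

(* a is only used on the indices 1..m.  The ordering of the a i is already a
   consequence of their being consecutive. *)
definition conjecture_C :: bool where
  "conjecture_C \<longleftrightarrow>
     (\<forall>m::nat. m \<ge> 1 \<longrightarrow>
       (\<forall>a :: nat \<Rightarrow> int.
          (\<forall>i\<in>{1..<m}. a (i + 1) = a i + 1) \<and>
          (int m)\<^sup>2 < a 1 \<and> strict_mono_on {1..m} a \<and> a m < (int m + 1)\<^sup>2
          \<longrightarrow> (\<exists>i\<in>{1..m}. prime (a i))))"

(* Number of primes in the closed interval with endpoints x and y, taken in either order. *)
definition primes_between :: "real \<Rightarrow> real \<Rightarrow> nat" where
  "primes_between x y = card {p::nat. prime p \<and> min x y \<le> real p \<and> real p \<le> max x y}"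

(* The denominator is nonzero whenever 1 < \<beta> < 2, as \<beta> is then not an integer. *)
definition f_fun :: "real \<Rightarrow> nat \<Rightarrow> real" where
  "f_fun \<beta> n =
     ((real n - (real_of_int \<lfloor>sqrt (real n)\<rfloor>)\<^sup>2 - real_of_int \<lfloor>sqrt (real n)\<rfloor> - \<beta>) /
      \<bar>real n - (real_of_int \<lfloor>sqrt (real n)\<rfloor>)\<^sup>2 - real_of_int \<lfloor>sqrt (real n)\<rfloor> - \<beta>\<bar>)
     * (1 - real_of_int \<lfloor>sqrt (real n)\<rfloor>)"

definition g_fun :: "nat \<Rightarrow> int" where
  "g_fun n = \<lfloor>1 - sqrt (real n) + real_of_int \<lfloor>sqrt (real n)\<rfloor>\<rfloor>"

end

theory Submission
  imports Defs
begin

text \<open>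
  For \<open>k\<^sup>2 \<le> n < (k + 1)\<^sup>2\<close> we have \<open>\<lfloor>sqrt n\<rfloor> = k\<close>, \<open>g n\<close> is \<open>1\<close> or \<open>0\<close> according to whether
  \<open>n = k\<^sup>2\<close> or not, and \<open>f n\<close> is \<open>k - 1\<close> for \<open>n \<le> k\<^sup>2 + k + 1\<close> and \<open>1 - k\<close> beyond that.
  Hence the interval attached to \<open>n\<close> consists of \<open>k\<close> consecutive integers strictly between \<open>k\<^sup>2\<close>
  and \<open>(k + 1)\<^sup>2\<close>. Conversely a run of \<open>m\<close> consecutive integers strictly between \<open>m\<^sup>2\<close> and
  \<open>(m + 1)\<^sup>2\<close> starts at some \<open>n \<le> m\<^sup>2 + m + 1\<close>, and is the interval attached to that \<open>n\<close>.
\<close>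

text \<open>\<open>card\<close> returns 0 on an infinite set, so passing from a witness to a count
  of at least 1 needs finiteness: the primes counted are bounded by \<open>max x y\<close>.\<close>

lemma primes_between_ge_1_iff:
  "primes_between x y \<ge> 1 \<longleftrightarrow> (\<exists>p. prime p \<and> min x y \<le> real p \<and> real p \<le> max x y)"
proof -
  have "{p::nat. prime p \<and> min x y \<le> real p \<and> real p \<le> max x y} \<subseteq> {..nat \<lfloor>max x y\<rfloor>}"
    by (auto simp: le_nat_floor simp del: le_max_iff_disj)
  then have "finite {p::nat. prime p \<and> min x y \<le> real p \<and> real p \<le> max x y}"
    by (rule finite_subset) simp
  then show ?thesis
    unfolding primes_between_def
    by (metis (no_types, lifting) Collect_empty_eq One_nat_def Suc_leI card_gt_0_iff
        not_one_le_zero card.empty)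
qed

lemma floor_sqrt_of_nat_eq:
  assumes "k\<^sup>2 \<le> n" "n < (k + 1)\<^sup>2"
  shows "\<lfloor>sqrt (real n)\<rfloor> = int k"
proof (rule floor_unique)
  show "real_of_int (int k) \<le> sqrt (real n)"
    using assms(1) by (simp add: real_le_rsqrt flip: of_nat_power)
  have "real n < (real k + 1)\<^sup>2"
    using assms(2) by (metis of_nat_1 of_nat_add of_nat_less_iff of_nat_power)
  then show "sqrt (real n) < real_of_int (int k) + 1"
    by (simp add: real_less_lsqrt)
qed

lemma floor_sqrt_bracket:
  fixes n :: nat
  assumes "n \<ge> 1"
  obtains k :: nat where "k \<ge> 1" "k\<^sup>2 \<le> n" "n < (k + 1)\<^sup>2"
proof
  let ?k = "nat \<lfloor>sqrt (real n)\<rfloor>"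
  have k: "real ?k \<le> sqrt (real n)" "sqrt (real n) < real ?k + 1"
    by (simp_all add: of_nat_nat)
  have "1 \<le> sqrt (real n)" using assms by simp
  then show "?k \<ge> 1" using k by linarith
  have "real (?k\<^sup>2) \<le> real n"
    using k(1) by (metis of_nat_0_le_iff of_nat_power real_sqrt_ge_0_iff real_sqrt_pow2 power_mono)
  then show "?k\<^sup>2 \<le> n" by linarith
  have "real n < real ((?k + 1)\<^sup>2)"
    using k(2) power_strict_mono[of "sqrt (real n)" "real ?k + 1" 2] by (simp add: add.commute)
  then show "n < (?k + 1)\<^sup>2" by linarith
qed

text \<open>For non-square n, \<open>sqrt n\<close> lies strictly between k and k + 1, so the number
  under the floor lies strictly between 0 and 1; at a square it equals 1.\<close>

lemma g_fun_eq:
  assumes "k\<^sup>2 \<le> n" "n < (k + 1)\<^sup>2"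
  shows "g_fun n = (if n = k\<^sup>2 then 1 else 0)"
proof (cases "n = k\<^sup>2")
  case True
  then show ?thesis by (simp add: g_fun_def)
next
  case False
  have fl: "\<lfloor>sqrt (real n)\<rfloor> = int k" by (rule floor_sqrt_of_nat_eq[OF assms])
  have "(real k)\<^sup>2 < real n" using assms(1) False
    by (metis le_neq_implies_less of_nat_less_iff of_nat_power)
  then have "real k < sqrt (real n)" by (rule real_less_rsqrt)
  moreover have "sqrt (real n) < real k + 1" using fl by linarith
  ultimately show ?thesis
    using False unfolding g_fun_def fl by (intro trans[OF floor_unique[where z = 0]]) simp_all
qed

lemma f_fun_eq:
  assumes "1 < \<beta>" "\<beta> < 2" "k\<^sup>2 \<le> n" "n < (k + 1)\<^sup>2"
  shows "f_fun \<beta> n = (if n \<le> k\<^sup>2 + k + 1 then real k - 1 else 1 - real k)"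
proof -
  have fl: "\<lfloor>sqrt (real n)\<rfloor> = int k" by (rule floor_sqrt_of_nat_eq[OF assms(3,4)])
  define d where "d = real n - (real k)\<^sup>2 - real k - \<beta>"
  have f: "f_fun \<beta> n = d / \<bar>d\<bar> * (1 - real k)"
    by (simp add: f_fun_def fl d_def)
  show ?thesis
  proof (cases "n \<le> k\<^sup>2 + k + 1")
    case True
    then have "real n \<le> real (k\<^sup>2 + k + 1)" by linarith
    then have "d < 0" using assms(1) by (simp add: d_def)
    then show ?thesis using True f by simp
  next
    case False
    then have "real n \<ge> real (k\<^sup>2 + k + 2)" by linarith
    then have "d > 0" using assms(2) by (simp add: d_def)
    then show ?thesis using False f by simp
  qed
qed

text \<open>A run is encoded by its first element \<open>s\<close> and its length \<open>k\<close>.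
  Its last element is s + k - 1, so the strict upper bound on it becomes a weak one on s +
  k.\<close>

lemma conjecture_C_iff:
  "conjecture_C \<longleftrightarrow>
     (\<forall>k::nat. k \<ge> 1 \<longrightarrow> (\<forall>s. k\<^sup>2 < s \<and> s + k \<le> (k + 1)\<^sup>2 \<longrightarrow> (\<exists>p. prime p \<and> s \<le> p \<and> p < s + k)))"
  (is "_ \<longleftrightarrow> ?R")
proof
  assume C: conjecture_C
  show ?R
  proof (intro allI impI, elim conjE)
    fix k s :: nat
    assume k: "k \<ge> 1" and s: "k\<^sup>2 < s" "s + k \<le> (k + 1)\<^sup>2"
    define a where "a i = int s + int i - 1" for i
    have "int s + int k \<le> (int k + 1)\<^sup>2"
      using s(2) by (metis of_nat_1 of_nat_add of_nat_le_iff of_nat_power)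
    moreover have "(int k)\<^sup>2 < int s" using s(1) by (metis of_nat_less_iff of_nat_power)
    ultimately have "\<exists>i\<in>{1..k}. prime (a i)"
      using C[unfolded conjecture_C_def, rule_format, OF k, of a]
      by (auto simp: a_def strict_mono_on_def)
    then obtain i where i: "i \<in> {1..k}" "prime (a i)" by blast
    have "a i = int (s + i - 1)" using i(1) by (simp add: a_def)
    then have "prime (s + i - 1)" using i(2) by (metis prime_nat_int_transfer)
    then show "\<exists>p. prime p \<and> s \<le> p \<and> p < s + k"
      using i(1) by (intro exI[of _ "s + i - 1"]) auto
  qed
next
  assume R: ?R
  show conjecture_C
    unfolding conjecture_C_def
  proof (intro allI impI, elim conjE)
    fix m :: nat and a :: "nat \<Rightarrow> int"
    assume m: "m \<ge> 1" and step: "\<forall>i\<in>{1..<m}. a (i + 1) = a i + 1"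
      and lo: "(int m)\<^sup>2 < a 1" and hi: "a m < (int m + 1)\<^sup>2"
    \<comment> \<open>The sequence is constrained only on the indices 1 to m, so the induction
      starts at 1 and carries the bound by m.\<close>
    have a: "i \<ge> 1 \<Longrightarrow> i \<le> m \<Longrightarrow> a i = a 1 + int i - 1" for i
    proof (induction i rule: dec_induct)
      case (step i)
      then show ?case using \<open>\<forall>i\<in>{1..<m}. _ i\<close> by simp
    qed simp
    define s where "s = nat (a 1)"
    have "0 \<le> a 1" using lo zero_le_power2[of "int m"] by linarith
    then have s: "int s = a 1" by (simp add: s_def)
    have "int (m\<^sup>2) < int s" using lo s by simp
    then have "m\<^sup>2 < s" by linarith
    moreover have "int (s + m) \<le> int ((m + 1)\<^sup>2)"
      using hi a[OF m order_refl] s by (simp add: add.commute)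
    then have "s + m \<le> (m + 1)\<^sup>2" by linarith
    ultimately obtain p where p: "prime p" "s \<le> p" "p < s + m" using R m by blast
    have "a (p - s + 1) = int p" using a[of "p - s + 1"] p s by simp
    then show "\<exists>i\<in>{1..m}. prime (a i)"
      using p by (intro bexI[of _ "p - s + 1"]) auto
  qed
qed

theorem theorem4p2:
  fixes \<beta> :: real
  assumes "1 < \<beta>" and "\<beta> < 2"
  shows "conjecture_C \<longleftrightarrow>
    (\<forall>n::nat. n \<ge> 1 \<longrightarrow>
      primes_between (real n + real_of_int (g_fun n))
                     (real n + f_fun \<beta> n + real_of_int (g_fun n)) \<ge> 1)"
  (is "_ \<longleftrightarrow> ?R")
proof
  assume C: conjecture_C
  show ?R
  proof (intro allI impI)
    fix n :: nat
    assume "n \<ge> 1"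
    then obtain k where k: "k \<ge> 1" "k\<^sup>2 \<le> n" "n < (k + 1)\<^sup>2" by (rule floor_sqrt_bracket)
    note fg = f_fun_eq[OF assms k(2,3)] g_fun_eq[OF k(2,3)]
    have sq: "(k + 1)\<^sup>2 = k\<^sup>2 + 2 * k + 1" by (simp add: power2_eq_square)
    \<comment> \<open>Left end of the interval attached to n: shifted by g at a square, n itself
      while f is k - 1, and n + f once f is 1 - k.\<close>
    define s where "s = (if n = k\<^sup>2 then n + 1 else if n \<le> k\<^sup>2 + k + 1 then n else n + 1 - k)"
    have "k\<^sup>2 < s \<and> s + k \<le> (k + 1)\<^sup>2"
      using k unfolding s_def sq by auto
    then obtain p where p: "prime p" "s \<le> p" "p < s + k"
      using C k(1) unfolding conjecture_C_iff by blast
    then have "real s \<le> real p" "real p \<le> real s + real k - 1" by linarith+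
    \<comment> \<open>The subtraction does not truncate: its branch has n > k.\<close>
    moreover have "real s =
      (if n = k\<^sup>2 then real n + 1 else if n \<le> k\<^sup>2 + k + 1 then real n else real n + 1 - real k)" (is "_ = ?r")
      by (auto simp: s_def of_nat_diff)
    ultimately have "?r \<le> real p" "real p \<le> ?r + real k - 1"
      by simp_all
    then show "primes_between (real n + real_of_int (g_fun n))
                     (real n + f_fun \<beta> n + real_of_int (g_fun n)) \<ge> 1"
      unfolding primes_between_ge_1_iff fg using p(1) k(1)
      by (intro exI[of _ p]) (auto split: if_splits)
  qed
next
  assume R: ?R
  show conjecture_C
    unfolding conjecture_C_iff
  proof (intro allI impI, elim conjE)
    fix k n :: nat
    assume k: "k \<ge> 1" "k\<^sup>2 < n" "n + k \<le> (k + 1)\<^sup>2"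
    have sq: "(k + 1)\<^sup>2 = k\<^sup>2 + 2 * k + 1" by (simp add: power2_eq_square)
    have b: "k\<^sup>2 \<le> n" "n < (k + 1)\<^sup>2" "n \<ge> 1" using k by auto
    have f: "f_fun \<beta> n = real k - 1" using f_fun_eq[OF assms b(1,2)] k(3) sq by simp
    have g: "g_fun n = 0" using g_fun_eq[OF b(1,2)] k(2) by simp
    obtain p where p: "prime p" "min (real n) (real n + (real k - 1)) \<le> real p"
      "real p \<le> max (real n) (real n + (real k - 1))"
      using R b(3) unfolding primes_between_ge_1_iff by (force simp: f g)
    then have "real n \<le> real p" "real p < real n + real k" using k(1) by linarith+
    then show "\<exists>p. prime p \<and> n \<le> p \<and> p < n + k"
      using p(1) by (intro exI[of _ p]) linarith
  qed
qed

end
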